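(* Let $n\in\mathbb{N}$, $n\ge 1$, $\mathcal V=\{1,\dots,n\}$. Let $\mathcal X=\mathcal X_1\times\cdots\times\mathcal X_n\subset\mathbb R^n$ be nonempty, convex and compact, with $\mathcal X_i\subset\mathbb R$ for each $i\in\mathcal V$. Let $f:\mathbb R^n\to\mathbb R$ be of the form $f(x)=\sum_{i=1}^n f_i(x_{\mathcal V^i})$ (see context) and twice continuously differentiable, and suppose its Hessian $H(x)=\nabla^2 f(x)$ satisfies, for some $\mu>0$, $H_{ii}(x)\ge \mu+\sum_{j=1,j\ne i}^n|H_{ij}(x)|$ for all $x\in\mathcal X$ and all $i\in\mathcal V$. Let $x^\star$ be the unique minimizer of $f$ over $\mathcal X$ and $z^\star=(x^\star,x^\star)$. Suppose that for each $i\in\mathcal V$ and each essential neighbor $j\in\mathcal V^i$ the sets $K^i$ (update times) and $R^i_j$ (communication times) are infinite, and that if $\{k_s\}_{s\in\mathbb N}$ is an increasing sequence of times in $K^i$ then $\lim_{s\to\infty}\tau^i_j(k_s)=\infty$ for all $j\in\mathcal V$. Let $\epsilon>0$, and let $$\gamma\in\left(0,\frac{1}{\max_{i\in\mathcal V}\max_{\eta\in\mathcal X}|H_{ii}(\eta)|}\right)\quad\text{and}\quad\lambda\in\left(0,\frac{\gamma\mu}{2(1-\gamma\mu)}\right).$$ Then, when running the totally asynchronous NAG algorithm (defined in the context), in order for agent $i$ to be within $\epsilon$ of the minimizer $z^\star$ for all $i\in\mathcal V$, i.e. to attain $$\max_{i\in\mathcal V}\|z^i(k)-z^\star\|_\infty\le\epsilon,$$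 agent $i$ must have performed at least $\beta$ computations and communicated at least $\beta|\mathcal V^i|$ times, where $$\beta=\frac{\log(\epsilon/D_0)}{\log(\alpha)},\qquad D_0=\max_{v_1,v_2\in\mathcal Z}\|v_1-v_2\|_\infty,\qquad \mathcal Z=\mathcal X\times\mathcal X,$$ and $\alpha=\max\{\alpha_1,\alpha_2\}$ with $$\alpha_1=\bigl(1+\lambda-\gamma\mu(1+\lambda)\bigr)^2+\lambda(1-\gamma\mu)+\lambda(1-\gamma\mu)\bigl(1+\lambda-\gamma\mu(1+\lambda)\bigr),\qquad \alpha_2=1-\gamma\mu+2\lambda(1-\gamma\mu).$$
   Context: Essential neighbors: $\mathcal V^i\subseteq\mathcal V$ is the set of indices $j\ne i$ such that $x_j$ explicitly appears in $\nabla_i f=\partial f/\partial x_i$. The objective has the form $f(x)=\sum_{i=1}^n f_i(x_{\mathcal V^i})$ with $f_i:\mathbb R^{|\mathcal V^i|+1}\to\mathbb R$, where $x_{\mathcal V^i}$ contains $x_i$ and all $x_j$, $j\in\mathcal V^i$. Agents communicate exactly with their essential neighbors. Norms and projection: $\Pi_{\mathcal X_i}$ is the orthogonal projection onto $\mathcal X_i$. For $v\in\mathbb R^n$, $\|v\|_\infty=\max_i|v_i|$; for a pair $(v,w)\in\mathbb R^n\times\mathbb R^n$, $\|(v,w)\|_\infty=\max_{i\in\mathcal V}\max\{|v_i|,|w_i|\}$. The assumptions imply $f$ has a unique minimizer over $\mathcal X$. Local states: agent $i$ stores at time $k$ a local copy $z^i(k)=(x^i(k),y^i(k))\in\mathcal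 Z=\mathcal X\times\mathcal X$ of all decision variables, with components $x^i_j(k),y^i_j(k)$, $j\in\mathcal V$. Agent $i$ only computes updates of $(x^i_i,y^i_i)\in\mathcal Z_i=\mathcal X_i\times\mathcal X_i$. Double-step update law: $u^i:\mathcal Z\to\mathcal Z_i$ maps $(x^i(k),y^i(k))$ to $(x^i_i(k+1),y^i_i(k+1))$ given by $$y^i_i(k+1)=\Pi_{\mathcal X_i}\Bigl[x^i_i(k)+\lambda\bigl(x^i_i(k)-y^i_i(k)\bigr)-\gamma\nabla_i f\bigl(x^i(k)+\lambda(x^i(k)-y^i(k))\bigr)\Bigr],$$ $$x^i_i(k+1)=\Pi_{\mathcal X_i}\Bigl[y^i_i(k+1)+\lambda\bigl(y^i_i(k+1)-x^i_i(k)\bigr)-\gamma\nabla_i f\bigl(y^i(k+1)+\lambda(y^i(k+1)-x^i(k))\bigr)\Bigr],$$ where in the second formula $y^i(k+1)$ is the vector whose $i$-th entry is the new $y^i_i(k+1)$ and whose $j$-th entry is $y^i_j(k)$ for $j\ne i$. Totally asynchronous NAG algorithm: $K^i\subseteq\mathbb N$ is the set of times at which agent $i$ computes an update, and $R^i_j\subseteq\mathbb N$ is the set of times at which agent $i$ receives a communication from its essential neighbor $j$ ($R^i_j=\emptyset$ if $j\notin\mathcal V^i$). Starting from arbitrary $z^i(0)\in\mathcal Z$, at each time $k\in\mathbb N$, for each $i\in\mathcal V$: if $k\in K^i$, then $(x^i_i(k+1),y^i_i(k+1))\leftarrow u^i(x^i(k),y^i(k))$, and agent $i$ sends the new pair to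 each $j\in\mathcal V^i$ (messages may be received with arbitrary delay, and agent $i$ may not communicate every one of its updated values; a communication received at time $k$ is not incorporated into the update computed at time $k$ until after both $x^i_i$ and $y^i_i$ have been updated); for each $j\in\mathcal V^i$ with $k\in R^i_j$, $(x^i_j(k),y^i_j(k))\leftarrow(x^j_j(\tau^i_j(k)),y^j_j(\tau^i_j(k)))$; for $m\notin\mathcal V^i$, $m\ne i$, the entries $(x^i_m,y^i_m)$ stay at their previous values. Entries not changed by a computation or communication are kept constant. Here $\tau^i_j(k)\in K^j$ is the time at which agent $j$ originally computed the values of $x^j_j,y^j_j$ that agent $i$ has onboard at time $k$, i.e. the earliest time in $K^j$ with $(x^i_j(k),y^i_j(k))=(x^j_j(\tau^i_j(k)),y^j_j(\tau^i_j(k)))$. Operation cycles (the paper's unit for counting computations and communications): an operation cycle is completed when (i) every agent $i\in\mathcal V$ has computed an update to its decision variables, (ii) it has sent these updated values to all of its essential neighbors, and (iii) every essential neighbor $j\in\mathcal V^i$ has received these values and incorporated them into its local state vector; then the next cycle begins. $\mathrm{ops}(k)$ is the number of cycles completed by time $k$, with $\mathrm{ops}(0)=0$. In each cycle, agent $i$ performs at least one computation and sends information to essential neighbors at least $|\mathcal V^i|$ total times.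
   Formalization: "Must" is read as: the guarantee α^ops(k)·D0 ≤ ε holds iff ops(k) ≥ β. Dominance and γ|H_ii| ≤ 1 are also assumed at points x+λ(x−y). Error covers essential entries; others must start within ε. A cycle needs new values not later overwritten by older ones. *)

theory Defs
  imports "HOL-Analysis.Analysis"
begin

section \<open>Partial derivatives, Hessian, essential neighbors\<close>

definition partial_deriv :: "'n::finite \<Rightarrow> (real^'n \<Rightarrow> real) \<Rightarrow> real^'n \<Rightarrow> real" where
  "partial_deriv i f x = frechet_derivative f (at x) (axis i 1)"

definition hessian :: "(real^'n::finite \<Rightarrow> real) \<Rightarrow> real^'n \<Rightarrow> real^'n^'n" where
  "hessian f x = (\<chi> i j. partial_deriv j (partial_deriv i f) x)"

definition twice_continuously_differentiable :: "(real^'n::finite \<Rightarrow> real) \<Rightarrow> bool" where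
  "twice_continuously_differentiable f \<longleftrightarrow>
     (\<forall>x. f differentiable (at x)) \<and>
     (\<forall>i x. partial_deriv i f differentiable (at x)) \<and>
     (\<forall>i j. continuous_on UNIV (\<lambda>x. hessian f x $ i $ j))"

text \<open>The variable with index \<open>j\<close> appears in the \<open>i\<close>-th partial derivative iff changing this
  one variable can change its value.\<close>

definition nbrs :: "(real^'n::finite \<Rightarrow> real) \<Rightarrow> 'n \<Rightarrow> 'n set" where
  "nbrs f i = {j. j \<noteq> i \<and>
     (\<exists>x y. (\<forall>l. l \<noteq> j \<longrightarrow> x $ l = y $ l) \<and> partial_deriv i f x \<noteq> partial_deriv i f y)}"

definition box_product :: "('n::finite \<Rightarrow> real set) \<Rightarrow> (real^'n) set" where
  "box_product Xs = {x. \<forall>i. x $ i \<in> Xs i}"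


section \<open>The update law\<close>

definition upd_entry :: "real^'n::finite \<Rightarrow> 'n \<Rightarrow> real \<Rightarrow> real^'n" where
  "upd_entry v i a = (\<chi> j. if j = i then a else v $ j)"

text \<open>The state is a pair \<open>(x, y)\<close>. The points \<open>w\<close> and \<open>w'\<close> at which the gradient is
  evaluated may lie outside of \<open>box_product Xs\<close>, even if \<open>x\<close> and \<open>y\<close> are in it.\<close>

definition nag_update ::
  "(real^'n::finite \<Rightarrow> real) \<Rightarrow> ('n \<Rightarrow> real set) \<Rightarrow> real \<Rightarrow> real \<Rightarrow> 'n \<Rightarrow> (real^'n) \<times> (real^'n) \<Rightarrow> real \<times> real"
  where
  "nag_update f Xs \<gamma> lam i p =
    (let x = fst p; y = snd p;
         w = x + lam *\<^sub>R (x - y);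
         yi = closest_point (Xs i) (w $ i - \<gamma> * partial_deriv i f w);
         y' = upd_entry y i yi;
         w' = y' + lam *\<^sub>R (y' - x);
         xi = closest_point (Xs i) (yi + lam * (yi - x $ i) - \<gamma> * partial_deriv i f w')
     in (xi, yi))"


section \<open>Runs of the totally asynchronous algorithm\<close>

definition entry :: "(real^'n::finite) \<times> (real^'n) \<Rightarrow> 'n \<Rightarrow> real \<times> real" where
  "entry p j = (fst p $ j, snd p $ j)"

text \<open>
  \<^item> \<open>z i k\<close> is the local state of agent \<open>i\<close> at time \<open>k\<close>; events at time \<open>k\<close> act on \<open>z i k\<close> and
    become visible in \<open>z i (Suc k)\<close>. In particular a message received at time \<open>k\<close> is not used
    by the update computed at time \<open>k\<close>.
  \<^item> \<open>S i j\<close> is the set of those update times of agent \<open>i\<close> whose result is sent to agent \<open>j\<close>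
    (not every computed value needs to be sent).
  \<^item> \<open>R i j\<close> is the set of times at which agent \<open>i\<close> receives a message from agent \<open>j\<close>.
  \<^item> \<open>\<tau> i j k\<close> is the time at which agent \<open>j\<close> computed the pair that agent \<open>i\<close> has onboard for
    agent \<open>j\<close> at time \<open>k\<close>. The result of the computation at time \<open>c\<close> is \<open>entry (z j (Suc c)) j\<close>.
    Before the first message arrives, agent \<open>i\<close> holds an arbitrary initial value and
    \<open>\<tau> i j k\<close> is meaningless.

  Delays are arbitrary: messages may be lost, duplicated, or overtake each other.\<close>

definition nag_run ::
  "(real^'n::finite \<Rightarrow> real) \<Rightarrow> ('n \<Rightarrow> real set) \<Rightarrow> real \<Rightarrow> real \<Rightarrow>
   ('n \<Rightarrow> nat set) \<Rightarrow> ('n \<Rightarrow> 'n \<Rightarrow> nat set) \<Rightarrow> ('n \<Rightarrow> 'n \<Rightarrow> nat set) \<Rightarrow> ('n \<Rightarrow> 'n \<Rightarrow> nat \<Rightarrow> nat) \<Rightarrow>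
   ('n \<Rightarrow> nat \<Rightarrow> (real^'n) \<times> (real^'n)) \<Rightarrow> bool"
  where
  "nag_run f Xs \<gamma> lam K S R \<tau> z \<longleftrightarrow>
     (\<forall>i. z i 0 \<in> box_product Xs \<times> box_product Xs) \<and>
     (\<forall>i j. S i j \<subseteq> K i) \<and>
     (\<forall>i j. j \<notin> nbrs f i \<longrightarrow> S i j = {} \<and> R i j = {}) \<and>
     (\<forall>i k. entry (z i (Suc k)) i =
        (if k \<in> K i then nag_update f Xs \<gamma> lam i (z i k) else entry (z i k) i)) \<and>
     (\<forall>i j k. j \<noteq> i \<longrightarrow>
        (if k \<in> R i j
         then \<tau> i j (Suc k) \<in> S j i \<and> \<tau> i j (Suc k) \<le> k \<and>
              entry (z i (Suc k)) j = entry (z j (Suc (\<tau> i j (Suc k)))) j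
         else \<tau> i j (Suc k) = \<tau> i j k \<and> entry (z i (Suc k)) j = entry (z i k) j))"

definition num_computations :: "('n \<Rightarrow> nat set) \<Rightarrow> 'n \<Rightarrow> nat \<Rightarrow> nat" where
  "num_computations K i k = card {c \<in> K i. c < k}"

definition num_communications :: "('n::finite \<Rightarrow> 'n \<Rightarrow> nat set) \<Rightarrow> 'n \<Rightarrow> nat \<Rightarrow> nat" where
  "num_communications S i k = (\<Sum>j\<in>UNIV. card {c \<in> S i j. c < k})"


section \<open>Operation cycles\<close>

text \<open>\<open>cycle_done N K S R \<tau> s t\<close>: the cycle begun at time \<open>s\<close> is complete at time \<open>t\<close> (events
  at times in \<open>{s..<t}\<close> have taken effect); \<open>N\<close> gives the essential neighbors. The last conjunct
  says that the neighbor has incorporated the new information for good: a message computed before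
  the cycle that is delivered late does not overwrite it. If messages on each channel arrive in
  the order in which they were computed, that conjunct follows from the preceding one.\<close>

definition cycle_done ::
  "('n \<Rightarrow> 'n set) \<Rightarrow> ('n \<Rightarrow> nat set) \<Rightarrow> ('n \<Rightarrow> 'n \<Rightarrow> nat set) \<Rightarrow> ('n \<Rightarrow> 'n \<Rightarrow> nat set) \<Rightarrow>
   ('n \<Rightarrow> 'n \<Rightarrow> nat \<Rightarrow> nat) \<Rightarrow> nat \<Rightarrow> nat \<Rightarrow> bool"
  where
  "cycle_done N K S R \<tau> s t \<longleftrightarrow>
     (\<forall>i. (\<exists>c\<in>K i. s \<le> c \<and> c < t) \<and>
          (\<forall>j\<in>N i.
             (\<exists>c\<in>S i j. s \<le> c \<and> (\<exists>r\<in>R j i. c \<le> r \<and> r < t \<and> \<tau> j i (Suc r) = c)) \<and>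
             (\<forall>k\<ge>t. s \<le> \<tau> j i k)))"

text \<open>Number of cycles completed by time \<open>k\<close>, and the time at which the current cycle began.\<close>

primrec cycle_state ::
  "('n \<Rightarrow> 'n set) \<Rightarrow> ('n \<Rightarrow> nat set) \<Rightarrow> ('n \<Rightarrow> 'n \<Rightarrow> nat set) \<Rightarrow> ('n \<Rightarrow> 'n \<Rightarrow> nat set) \<Rightarrow>
   ('n \<Rightarrow> 'n \<Rightarrow> nat \<Rightarrow> nat) \<Rightarrow> nat \<Rightarrow> nat \<times> nat"
  where
  "cycle_state N K S R \<tau> 0 = (0, 0)"
| "cycle_state N K S R \<tau> (Suc k) =
     (let (m, s) = cycle_state N K S R \<tau> k
      in if cycle_done N K S R \<tau> s (Suc k) then (Suc m, Suc k) else (m, s))"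

definition ops ::
  "('n \<Rightarrow> 'n set) \<Rightarrow> ('n \<Rightarrow> nat set) \<Rightarrow> ('n \<Rightarrow> 'n \<Rightarrow> nat set) \<Rightarrow> ('n \<Rightarrow> 'n \<Rightarrow> nat set) \<Rightarrow>
   ('n \<Rightarrow> 'n \<Rightarrow> nat \<Rightarrow> nat) \<Rightarrow> nat \<Rightarrow> nat"
  where
  "ops N K S R \<tau> k = fst (cycle_state N K S R \<tau> k)"


section \<open>Distances\<close>

text \<open>On pairs of vectors, the library's \<^const>\<open>infnorm\<close> is the maximum of the absolute values of
  all entries of both vectors. The following variant only looks at the entries in \<open>J\<close>. It is
  used with \<open>J = insert i (nbrs f i)\<close>, the entries that agent \<open>i\<close> ever changes in a run: its
  copies of all other variables keep their initial values forever.\<close>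

definition infnorm_on :: "'n::finite set \<Rightarrow> (real^'n) \<times> (real^'n) \<Rightarrow> real" where
  "infnorm_on J p = (MAX j\<in>J. max \<bar>fst p $ j\<bar> \<bar>snd p $ j\<bar>)"

end

theory Submission
  imports Defs
begin

text \<open>
  The error bound comes from a contraction in the maximum norm. If \<open>w\<close> is an extrapolated point, the
  map \<open>w \<mapsto> w\<^sub>i - \<gamma> \<partial>\<^sub>i f w\<close> has gradient \<open>e\<^sub>i - \<gamma> H\<^sub>i\<close>, and diagonal dominance bounds the
  absolute sum of its entries by \<open>1 - \<gamma> \<mu>\<close>. Extrapolation enlarges distances to \<open>xstar\<close> by at
  most \<open>1 + 2 lam\<close>, projections do not enlarge them, and \<open>xstar\<close> is a fixed point of the projected
  step. So both half steps of an update shrink the error by \<open>\<alpha>2 = (1 - \<gamma> \<mu>) (1 + 2 lam) < 1\<close>, and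
  hence by \<open>\<alpha>\<close> (\<open>gradient_step_contraction\<close>, \<open>nag_update_contraction\<close>). Only the essential
  entries of a local state enter, because the other entries of \<open>H\<^sub>i\<close> vanish.

  In a maximum norm, delays do no harm: an update contracts the error of whatever old values it uses.
  At the end of an operation cycle all essential entries stem from updates computed within that cycle,
  so each cycle multiplies the worst error by \<open>\<alpha>\<close>. This gives \<open>\<alpha>\<^sup>m D0\<close> after \<open>m\<close> cycles
  (\<open>error_bound_ops\<close>), and taking logarithms turns \<open>\<alpha>\<^sup>m D0 \<le> \<epsilon>\<close> into \<open>\<beta> \<le> m\<close>. A cycle describes
  what an agent sends to its essential neighbors, whereas the contraction needs what it receives
  from them. The two fit together because the neighbor relation is symmetric (\<open>nbrs_sym\<close>).

  Each cycle contains an update of every agent and a message on every channel, and different cycles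
  occupy disjoint time intervals; this gives the counts of computations and communications
  (\<open>ops_le_num_computations\<close>, \<open>card_nbrs_ops_le_num_communications\<close>). With ordered channels,
  every cycle is eventually completed (\<open>eventually_cycle_done\<close>), so the number of cycles reaches
  \<open>\<beta>\<close> at some time.
\<close>


section \<open>Directional derivatives and essential neighbors\<close>

lemma frechet_derivative_eq_sum_partial_deriv:
  fixes g :: "real^'n::finite \<Rightarrow> real"
  assumes "g differentiable (at x)"
  shows "frechet_derivative g (at x) d = (\<Sum>j\<in>UNIV. d $ j * partial_deriv j g x)"
proof -
  have lin: "linear (frechet_derivative g (at x))"
    using assms by (rule linear_frechet_derivative)
  have "frechet_derivative g (at x) d
      = frechet_derivative g (at x) (\<Sum>j\<in>UNIV. d $ j *\<^sub>R axis j 1)"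
    by (simp add: basis_expansion flip: scalar_mult_eq_scaleR)
  also have "\<dots> = (\<Sum>j\<in>UNIV. d $ j * partial_deriv j g x)"
    by (simp add: linear_sum[OF lin] linear_cmul[OF lin] partial_deriv_def)
  finally show ?thesis .
qed

lemma has_real_derivative_along_line:
  fixes g :: "real^'n::finite \<Rightarrow> real"
  assumes "\<And>x. g differentiable (at x)"
  shows "((\<lambda>t. g (x + t *\<^sub>R d)) has_real_derivative
           (\<Sum>j\<in>UNIV. d $ j * partial_deriv j g (x + t *\<^sub>R d))) (at t within T)"
proof -
  have "(g has_derivative frechet_derivative g (at (x + t *\<^sub>R d))) (at (x + t *\<^sub>R d))"
    using assms by (simp add: frechet_derivative_works)
  moreover have "((\<lambda>t. x + t *\<^sub>R d) has_derivative (\<lambda>h. h *\<^sub>R d)) (at t within T)"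
    by (auto intro!: derivative_eq_intros)
  ultimately have "((\<lambda>t. g (x + t *\<^sub>R d)) has_derivative
      (\<lambda>h. frechet_derivative g (at (x + t *\<^sub>R d)) (h *\<^sub>R d))) (at t within T)"
    by (rule has_derivative_compose[rotated])
  moreover have "(\<lambda>h. frechet_derivative g (at (x + t *\<^sub>R d)) (h *\<^sub>R d))
      = (*) (\<Sum>j\<in>UNIV. d $ j * partial_deriv j g (x + t *\<^sub>R d))"
    by (auto simp: frechet_derivative_eq_sum_partial_deriv[OF assms] sum_distrib_left mult_ac)
  ultimately show ?thesis
    by (simp add: has_field_derivative_def)
qed

lemma sum_scaled_axis:
  fixes h :: "'n::finite \<Rightarrow> real"
  shows "(\<Sum>l\<in>UNIV. (c *\<^sub>R axis j 1) $ l * h l) = c * h j"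
proof -
  have "(\<Sum>l\<in>UNIV. (c *\<^sub>R axis j 1) $ l * h l) = (\<Sum>l\<in>UNIV. if l = j then c * h l else 0)"
    by (intro sum.cong) (auto simp: axis_def)
  then show ?thesis by simp
qed

lemma has_real_derivative_along_axis:
  fixes g :: "real^'n::finite \<Rightarrow> real"
  assumes "\<And>x. g differentiable (at x)"
  shows "((\<lambda>t. g (x + t *\<^sub>R axis j 1)) has_real_derivative
           partial_deriv j g (x + t *\<^sub>R axis j 1)) (at t within T)"
  using has_real_derivative_along_line[OF assms, of x "axis j 1" t T]
    sum_scaled_axis[of 1 j "\<lambda>l. partial_deriv l g (x + t *\<^sub>R axis j 1)"] by simp

lemma partial_deriv_shift_non_nbr:
  assumes "j \<notin> nbrs f i" "j \<noteq> i"
  shows "partial_deriv i f (x + t *\<^sub>R axis j 1) = partial_deriv i f x"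
proof -
  have "\<forall>l. l \<noteq> j \<longrightarrow> (x + t *\<^sub>R axis j 1) $ l = x $ l" by (simp add: axis_def)
  then show ?thesis using assms unfolding nbrs_def by blast
qed

lemma hessian_non_nbr:
  assumes diff: "\<And>x. partial_deriv i f differentiable (at x)" and j: "j \<notin> nbrs f i" "j \<noteq> i"
  shows "hessian f x $ i $ j = 0"
proof -
  have "((\<lambda>t. partial_deriv i f (x + t *\<^sub>R axis j 1)) has_real_derivative
           hessian f x $ i $ j) (at 0)"
    using has_real_derivative_along_axis[OF diff, of x j 0 UNIV] by (simp add: hessian_def)
  moreover have "((\<lambda>t. partial_deriv i f (x + t *\<^sub>R axis j 1)) has_real_derivative 0) (at 0)"
    by (simp add: partial_deriv_shift_non_nbr[OF j])
  ultimately show ?thesis by (rule DERIV_unique)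
qed

text \<open>If \<open>\<partial>\<^sub>i f\<close> does not depend on \<open>x\<^sub>j\<close>, then integrating it along the \<open>i\<close>-th axis shows that
  the mixed second difference of \<open>f\<close> in the directions \<open>i\<close> and \<open>j\<close> vanishes. This condition is
  symmetric in \<open>i\<close> and \<open>j\<close>, so differentiating it along the \<open>j\<close>-th axis shows that \<open>\<partial>\<^sub>j f\<close> does
  not depend on \<open>x\<^sub>i\<close>. The proof below does this with the roles of \<open>i\<close> and \<open>j\<close> exchanged.\<close>

lemma nbrs_sym:
  fixes f :: "real^'n::finite \<Rightarrow> real"
  assumes diff: "\<And>x. f differentiable (at x)" and ij: "j \<in> nbrs f i"
  shows "i \<in> nbrs f j"
proof (rule ccontr)
  assume i: "i \<notin> nbrs f j"
  have "i \<noteq> j" using ij by (auto simp: nbrs_def)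
  let ?a = "\<lambda>j. axis j 1 :: real^'n"
  have mixed: "f (x + r *\<^sub>R ?a i + t *\<^sub>R ?a j) - f (x + t *\<^sub>R ?a j) = f (x + r *\<^sub>R ?a i) - f x"
    for x r t
  proof -
    let ?h = "\<lambda>t. f (x + r *\<^sub>R ?a i + t *\<^sub>R ?a j) - f (x + t *\<^sub>R ?a j)"
    have "(?h has_real_derivative 0) (at t)" for t
    proof -
      have "x + r *\<^sub>R ?a i + t *\<^sub>R ?a j = x + t *\<^sub>R ?a j + r *\<^sub>R ?a i" by simp
      then have "partial_deriv j f (x + r *\<^sub>R ?a i + t *\<^sub>R ?a j) = partial_deriv j f (x + t *\<^sub>R ?a j)"
        using partial_deriv_shift_non_nbr[OF i \<open>i \<noteq> j\<close>] by metis
      then show ?thesis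
        using DERIV_diff[OF has_real_derivative_along_axis[OF diff, of "x + r *\<^sub>R ?a i" j t UNIV]
            has_real_derivative_along_axis[OF diff, of x j t UNIV]] by simp
    qed
    then have "?h t = ?h 0" using DERIV_isconst_all by blast
    then show ?thesis by simp
  qed
  have shift: "partial_deriv i f (x + t *\<^sub>R ?a j) = partial_deriv i f x" for x t
  proof -
    have "((\<lambda>r. f (x + t *\<^sub>R ?a j + r *\<^sub>R ?a i)) has_real_derivative
            partial_deriv i f (x + t *\<^sub>R ?a j)) (at 0)"
      using has_real_derivative_along_axis[OF diff, of "x + t *\<^sub>R ?a j" i 0 UNIV] by simp
    moreover have "(\<lambda>r. f (x + t *\<^sub>R ?a j + r *\<^sub>R ?a i))
        = (\<lambda>r. f (x + r *\<^sub>R ?a i) + (f (x + t *\<^sub>R ?a j) - f x))"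
    proof
      fix r
      have "x + t *\<^sub>R ?a j + r *\<^sub>R ?a i = x + r *\<^sub>R ?a i + t *\<^sub>R ?a j" by simp
      with mixed[of x r t] show "f (x + t *\<^sub>R ?a j + r *\<^sub>R ?a i) = f (x + r *\<^sub>R ?a i) + (f (x + t *\<^sub>R ?a j) - f x)"
        by (simp only:)
    qed
    moreover have "((\<lambda>r. f (x + r *\<^sub>R ?a i) + (f (x + t *\<^sub>R ?a j) - f x)) has_real_derivative
            partial_deriv i f x) (at 0)"
      using DERIV_add[OF has_real_derivative_along_axis[OF diff, of x i 0 UNIV] DERIV_const] by simp
    ultimately show ?thesis using DERIV_unique by metis
  qed
  obtain x y where xy: "\<And>l. l \<noteq> j \<Longrightarrow> x $ l = y $ l" "partial_deriv i f x \<noteq> partial_deriv i f y"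
    using ij by (auto simp: nbrs_def)
  have "y = x + (y $ j - x $ j) *\<^sub>R ?a j"
    using xy(1) by (auto simp: vec_eq_iff axis_def)
  then show False using shift xy(2) by metis
qed


section \<open>Contraction of a single update\<close>

text \<open>Along a segment on which the \<open>i\<close>-th row of the Hessian is dominated by its diagonal entry, the
  derivative of \<open>w \<mapsto> w\<^sub>i - \<gamma> \<partial>\<^sub>i f w\<close> is the row \<open>e\<^sub>i - \<gamma> H\<^sub>i\<close>. The step size keeps its
  diagonal entry nonnegative, so its absolute row sum is at most \<open>1 - \<gamma> \<mu>\<close>. Columns outside of
  the essential neighbors vanish, so only the essential entries of \<open>w - v\<close> matter.\<close>

lemma gradient_step_contraction:
  fixes f :: "real^'n::finite \<Rightarrow> real"
  assumes diff: "\<And>x. partial_deriv i f differentiable (at x)"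
    and dom: "\<And>t. 0 < t \<Longrightarrow> t < 1 \<Longrightarrow>
          hessian f (v + t *\<^sub>R (w - v)) $ i $ i
            \<ge> \<mu> + (\<Sum>j\<in>UNIV - {i}. \<bar>hessian f (v + t *\<^sub>R (w - v)) $ i $ j\<bar>) \<and>
          \<gamma> * hessian f (v + t *\<^sub>R (w - v)) $ i $ i \<le> 1"
    and "\<gamma> \<ge> 0"
    and near: "\<And>j. j \<in> insert i (nbrs f i) \<Longrightarrow> \<bar>w $ j - v $ j\<bar> \<le> \<delta>"
  shows "\<bar>(w $ i - \<gamma> * partial_deriv i f w) - (v $ i - \<gamma> * partial_deriv i f v)\<bar>
           \<le> (1 - \<gamma> * \<mu>) * \<delta>"
proof -
  define d where "d = w - v"
  have "\<delta> \<ge> 0" using near[of i] by simp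
  let ?\<phi> = "\<lambda>t. t * d $ i - \<gamma> * partial_deriv i f (v + t *\<^sub>R d)"
  let ?H = "\<lambda>t j. hessian f (v + t *\<^sub>R d) $ i $ j"
  have "(?\<phi> has_real_derivative d $ i - \<gamma> * (\<Sum>j\<in>UNIV. d $ j * ?H t j)) (at t)" for t
    using has_real_derivative_along_line[OF diff, of v d t UNIV]
    by (auto simp: hessian_def intro!: derivative_eq_intros)
  then obtain t where t: "0 < t" "t < 1"
    and mvt: "?\<phi> 1 - ?\<phi> 0 = d $ i - \<gamma> * (\<Sum>j\<in>UNIV. d $ j * ?H t j)"
    using MVT2[of 0 1 ?\<phi> "\<lambda>t. d $ i - \<gamma> * (\<Sum>j\<in>UNIV. d $ j * ?H t j)"] by auto
  have row: "\<mu> + (\<Sum>j\<in>UNIV - {i}. \<bar>?H t j\<bar>) \<le> ?H t i" and diag: "\<gamma> * ?H t i \<le> 1"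
    using dom[OF t] by (auto simp: d_def)
  have entries: "\<bar>d $ j * ?H t j\<bar> \<le> \<bar>?H t j\<bar> * \<delta>" for j
  proof (cases "j \<in> insert i (nbrs f i)")
    case True
    then have "\<bar>d $ j\<bar> \<le> \<delta>" using near by (simp add: d_def)
    then show ?thesis using mult_right_mono[of "\<bar>d $ j\<bar>" \<delta> "\<bar>?H t j\<bar>"]
      by (simp add: abs_mult mult.commute)
  next
    case False
    then show ?thesis using hessian_non_nbr[OF diff] by simp
  qed
  have "d $ i - \<gamma> * (\<Sum>j\<in>UNIV. d $ j * ?H t j)
      = (1 - \<gamma> * ?H t i) * d $ i - \<gamma> * (\<Sum>j\<in>UNIV - {i}. d $ j * ?H t j)"
    by (simp add: sum.remove[of UNIV i] algebra_simps)
  also have "\<bar>\<dots>\<bar> \<le> \<bar>(1 - \<gamma> * ?H t i) * d $ i\<bar> + \<gamma> * \<bar>\<Sum>j\<in>UNIV - {i}. d $ j * ?H t j\<bar>"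
    using abs_triangle_ineq4[of "(1 - \<gamma> * ?H t i) * d $ i" "\<gamma> * (\<Sum>j\<in>UNIV - {i}. d $ j * ?H t j)"]
      \<open>\<gamma> \<ge> 0\<close> by (simp add: abs_mult)
  also have "\<bar>(1 - \<gamma> * ?H t i) * d $ i\<bar> \<le> (1 - \<gamma> * ?H t i) * \<delta>"
    using diag near[of i] by (simp add: abs_mult d_def mult_left_mono)
  also have "\<bar>\<Sum>j\<in>UNIV - {i}. d $ j * ?H t j\<bar> \<le> (\<Sum>j\<in>UNIV - {i}. \<bar>?H t j\<bar> * \<delta>)"
    by (rule order_trans[OF sum_abs sum_mono]) (rule entries)
  also have "(\<Sum>j\<in>UNIV - {i}. \<bar>?H t j\<bar> * \<delta>) = (\<Sum>j\<in>UNIV - {i}. \<bar>?H t j\<bar>) * \<delta>"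
    by (simp add: sum_distrib_right)
  also have "(1 - \<gamma> * ?H t i) * \<delta> + \<gamma> * ((\<Sum>j\<in>UNIV - {i}. \<bar>?H t j\<bar>) * \<delta>)
      = \<delta> - \<gamma> * \<delta> * (?H t i - (\<Sum>j\<in>UNIV - {i}. \<bar>?H t j\<bar>))"
    by (simp add: algebra_simps)
  also have "\<dots> \<le> \<delta> - \<gamma> * \<delta> * \<mu>"
    using row \<open>\<gamma> \<ge> 0\<close> \<open>\<delta> \<ge> 0\<close> by (simp add: mult_left_mono)
  finally have "\<bar>?\<phi> 1 - ?\<phi> 0\<bar> \<le> \<delta> - \<gamma> * \<delta> * \<mu>"
    using \<open>\<gamma> \<ge> 0\<close> unfolding mvt by (simp add: mult_left_mono)
  then show ?thesis by (simp add: d_def algebra_simps)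
qed

lemma box_product_component:
  fixes Xs :: "'n::finite \<Rightarrow> real set"
  assumes "box_product Xs \<noteq> {}" "convex (box_product Xs)" "compact (box_product Xs)"
  shows "closed (Xs i)" "convex (Xs i)" "Xs i \<noteq> {}"
proof -
  obtain x where x: "\<And>j. x $ j \<in> Xs j" using assms(1) by (auto simp: box_product_def)
  then have "a \<in> (\<lambda>v. v $ i) ` box_product Xs" if "a \<in> Xs i" for a
    using that by (intro image_eqI[of _ _ "upd_entry x i a"]) (auto simp: upd_entry_def box_product_def)
  then have image: "Xs i = (\<lambda>v. v $ i) ` box_product Xs"
    by (auto simp: box_product_def)
  show "closed (Xs i)" unfolding image
    by (intro compact_imp_closed compact_continuous_image assms continuous_intros)
  show "convex (Xs i)" unfolding image
    by (intro convex_linear_image assms linear_componentwise) (simp add: linear_iff)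
  show "Xs i \<noteq> {}" using x by blast
qed

text \<open>The first-order optimality condition in the \<open>i\<close>-th coordinate: a minimizer over a box is a fixed
  point of the projected gradient step.\<close>

lemma minimizer_projected_gradient_fixed:
  fixes f :: "real^'n::finite \<Rightarrow> real"
  assumes diff: "\<And>x. f differentiable (at x)"
    and xstar: "is_arg_min f (\<lambda>x. x \<in> box_product Xs) xstar"
    and Xi: "closed (Xs i)" "convex (Xs i)" and "\<gamma> \<ge> 0"
  shows "closest_point (Xs i) (xstar $ i - \<gamma> * partial_deriv i f xstar) = xstar $ i"
proof -
  have mem: "xstar $ j \<in> Xs j" for j
    using xstar by (auto simp: is_arg_min_def box_product_def)
  define g where "g = partial_deriv i f xstar"
  have slope: "(a - xstar $ i) * g \<ge> 0" if a: "a \<in> Xs i" for a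
  proof (rule ccontr)
    assume neg: "\<not> (a - xstar $ i) * g \<ge> 0"
    define d where "d = (a - xstar $ i) *\<^sub>R (axis i 1 :: real^'n)"
    have "((\<lambda>t. f (xstar + t *\<^sub>R d)) has_real_derivative (a - xstar $ i) * g) (at 0)"
      using has_real_derivative_along_line[OF diff, of xstar d 0 UNIV]
      unfolding d_def sum_scaled_axis by (simp add: g_def)
    then obtain e where e: "e > 0" "\<And>h. 0 < h \<Longrightarrow> h < e \<Longrightarrow> f (xstar + h *\<^sub>R d) < f xstar"
      using DERIV_neg_dec_right[of "\<lambda>t. f (xstar + t *\<^sub>R d)" "(a - xstar $ i) * g" 0] neg by auto
    define h where "h = min 1 (e / 2)"
    have h: "0 < h" "h < e" "h \<le> 1" using e(1) by (auto simp: h_def)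
    have "(1 - h) *\<^sub>R xstar $ i + h *\<^sub>R a \<in> Xs i"
      using h a mem by (intro convexD[OF Xi(2)]) auto
    then have "xstar + h *\<^sub>R d \<in> box_product Xs"
      using mem by (auto simp: box_product_def d_def axis_def algebra_simps)
    then show False using e(2)[OF h(1,2)] xstar by (auto simp: is_arg_min_def)
  qed
  have "xstar $ i = closest_point (Xs i) (xstar $ i - \<gamma> * g)"
  proof (rule closest_point_unique[OF Xi(2,1) mem], intro ballI)
    fix a assume "a \<in> Xs i"
    then have "0 \<le> 2 * \<gamma> * ((a - xstar $ i) * g)" using slope \<open>\<gamma> \<ge> 0\<close> by simp
    then have "(\<gamma> * g)\<^sup>2 \<le> (xstar $ i - \<gamma> * g - a)\<^sup>2"
      using zero_le_power2[of "xstar $ i - a"] by (simp add: power2_eq_square algebra_simps)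
    then have "\<bar>\<gamma> * g\<bar> \<le> \<bar>xstar $ i - \<gamma> * g - a\<bar>" by (simp add: abs_le_square_iff)
    then show "dist (xstar $ i - \<gamma> * g) (xstar $ i) \<le> dist (xstar $ i - \<gamma> * g) a"
      by (simp add: dist_real_def)
  qed
  then show ?thesis by (simp add: g_def)
qed

text \<open>Both components of a pair are compared with the same number \<open>a\<close>, because the limit
  \<open>(xstar, xstar)\<close> of the states has equal components.\<close>

definition entry_near :: "real \<Rightarrow> real \<Rightarrow> real \<times> real \<Rightarrow> bool" where
  "entry_near \<delta> a p \<longleftrightarrow> \<bar>fst p - a\<bar> \<le> \<delta> \<and> \<bar>snd p - a\<bar> \<le> \<delta>"

lemma entry_near_mono: "entry_near \<delta> a p \<Longrightarrow> \<delta> \<le> \<delta>' \<Longrightarrow> entry_near \<delta>' a p"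
  by (auto simp: entry_near_def)

text \<open>Extrapolation moves an entry that is within \<open>\<delta>\<close> of its target to within \<open>(1 + 2 lam) \<delta>\<close>.
  As the first half step does not leave the \<open>\<delta>\<close>-neighborhood, the same holds at the point used by
  the second half step, and both halves contract with the same factor.\<close>

lemma nag_update_contraction:
  fixes f :: "real^'n::finite \<Rightarrow> real"
  assumes diff: "\<And>x. f differentiable (at x)"
    and diff2: "\<And>x. partial_deriv i f differentiable (at x)"
    and box: "convex (box_product Xs)" "closed (Xs i)" "convex (Xs i)"
    and xstar: "is_arg_min f (\<lambda>x. x \<in> box_product Xs) xstar"
    and dom: "\<And>x y w. x \<in> box_product Xs \<Longrightarrow> y \<in> box_product Xs \<Longrightarrow> w = x + lam *\<^sub>R (x - y) \<Longrightarrow>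
          hessian f w $ i $ i \<ge> \<mu> + (\<Sum>j\<in>UNIV - {i}. \<bar>hessian f w $ i $ j\<bar>) \<and>
          \<gamma> * \<bar>hessian f w $ i $ i\<bar> \<le> 1"
    and "\<gamma> \<ge> 0" "lam \<ge> 0"
    and less_one: "(1 - \<gamma> * \<mu>) * (1 + 2 * lam) \<le> 1"
    and p: "p \<in> box_product Xs \<times> box_product Xs"
    and near: "\<And>j. j \<in> insert i (nbrs f i) \<Longrightarrow> entry_near \<delta> (xstar $ j) (entry p j)"
  shows "entry_near ((1 - \<gamma> * \<mu>) * (1 + 2 * lam) * \<delta>) (xstar $ i) (nag_update f Xs \<gamma> lam i p)"
proof -
  let ?X = "box_product Xs"
  have xstar_mem: "xstar \<in> ?X" using xstar by (simp add: is_arg_min_def)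
  have half_step: "\<bar>closest_point (Xs i) (w $ i - \<gamma> * partial_deriv i f w) - xstar $ i\<bar>
      \<le> (1 - \<gamma> * \<mu>) * (1 + 2 * lam) * \<delta>"
    if mem: "a \<in> ?X" "b \<in> ?X" and w: "w = a + lam *\<^sub>R (a - b)"
      and ab: "\<And>j. j \<in> insert i (nbrs f i) \<Longrightarrow> \<bar>a $ j - xstar $ j\<bar> \<le> \<delta> \<and> \<bar>b $ j - xstar $ j\<bar> \<le> \<delta>"
    for a b w
  proof -
    have "\<bar>closest_point (Xs i) (w $ i - \<gamma> * partial_deriv i f w) - xstar $ i\<bar>
        = dist (closest_point (Xs i) (w $ i - \<gamma> * partial_deriv i f w))
            (closest_point (Xs i) (xstar $ i - \<gamma> * partial_deriv i f xstar))"
      by (simp add: minimizer_projected_gradient_fixed[OF diff xstar box(2,3) \<open>\<gamma> \<ge> 0\<close>] dist_real_def)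
    also have "\<dots> \<le> dist (w $ i - \<gamma> * partial_deriv i f w) (xstar $ i - \<gamma> * partial_deriv i f xstar)"
      using xstar_mem by (intro closest_point_lipschitz box) (auto simp: box_product_def)
    also have "\<dots> \<le> (1 - \<gamma> * \<mu>) * ((1 + 2 * lam) * \<delta>)"
      unfolding dist_real_def
    proof (rule gradient_step_contraction[OF diff2 _ \<open>\<gamma> \<ge> 0\<close>])
      fix t :: real assume t: "0 < t" "t < 1"
      \<comment> \<open>The segment from \<open>xstar\<close> to \<open>w\<close> consists of extrapolated points, because extrapolation
        is linear and fixes \<open>xstar\<close>.\<close>
      let ?a = "(1 - t) *\<^sub>R xstar + t *\<^sub>R a" and ?b = "(1 - t) *\<^sub>R xstar + t *\<^sub>R b"
      have "?a \<in> ?X" "?b \<in> ?X"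
        using t mem xstar_mem by (auto intro!: convexD[OF box(1)])
      moreover have "xstar + t *\<^sub>R (w - xstar) = ?a + lam *\<^sub>R (?a - ?b)"
        by (simp add: w vec_eq_iff algebra_simps)
      ultimately have dom_t: "\<mu> + (\<Sum>j\<in>UNIV - {i}. \<bar>hessian f (xstar + t *\<^sub>R (w - xstar)) $ i $ j\<bar>)
            \<le> hessian f (xstar + t *\<^sub>R (w - xstar)) $ i $ i"
        "\<gamma> * \<bar>hessian f (xstar + t *\<^sub>R (w - xstar)) $ i $ i\<bar> \<le> 1"
        using dom by blast+
      have "\<gamma> * h \<le> \<gamma> * \<bar>h\<bar>" for h using \<open>\<gamma> \<ge> 0\<close> by (simp add: mult_left_mono)
      with dom_t show "\<mu> + (\<Sum>j\<in>UNIV - {i}. \<bar>hessian f (xstar + t *\<^sub>R (w - xstar)) $ i $ j\<bar>)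
            \<le> hessian f (xstar + t *\<^sub>R (w - xstar)) $ i $ i \<and>
          \<gamma> * hessian f (xstar + t *\<^sub>R (w - xstar)) $ i $ i \<le> 1"
        by (meson order_trans)
    next
      fix j assume j: "j \<in> insert i (nbrs f i)"
      have "w $ j - xstar $ j = (1 + lam) * (a $ j - xstar $ j) - lam * (b $ j - xstar $ j)"
        by (simp add: w algebra_simps)
      also have "\<bar>\<dots>\<bar> \<le> (1 + lam) * \<bar>a $ j - xstar $ j\<bar> + lam * \<bar>b $ j - xstar $ j\<bar>"
        using abs_triangle_ineq4[of "(1 + lam) * (a $ j - xstar $ j)" "lam * (b $ j - xstar $ j)"]
          \<open>lam \<ge> 0\<close> by (simp add: abs_mult)
      also have "\<dots> \<le> (1 + lam) * \<delta> + lam * \<delta>"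
        using ab[OF j] \<open>lam \<ge> 0\<close> by (intro add_mono mult_left_mono) auto
      finally show "\<bar>w $ j - xstar $ j\<bar> \<le> (1 + 2 * lam) * \<delta>" by (simp add: algebra_simps)
    qed
    finally show ?thesis by (simp add: mult.assoc)
  qed
  obtain x y where xy: "p = (x, y)" by (cases p)
  have mem: "x \<in> ?X" "y \<in> ?X" using p by (auto simp: xy)
  have near_xy: "\<bar>x $ j - xstar $ j\<bar> \<le> \<delta>" "\<bar>y $ j - xstar $ j\<bar> \<le> \<delta>"
    if "j \<in> insert i (nbrs f i)" for j
    using near[OF that] by (auto simp: entry_near_def entry_def xy)
  have "\<delta> \<ge> 0" using near_xy(1)[of i] by simp
  define w where "w = x + lam *\<^sub>R (x - y)"
  define yi where "yi = closest_point (Xs i) (w $ i - \<gamma> * partial_deriv i f w)"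
  define y' where "y' = upd_entry y i yi"
  define w' where "w' = y' + lam *\<^sub>R (y' - x)"
  have yi: "\<bar>yi - xstar $ i\<bar> \<le> (1 - \<gamma> * \<mu>) * (1 + 2 * lam) * \<delta>"
    unfolding yi_def by (rule half_step[OF mem w_def]) (use near_xy in blast)
  also have "\<dots> \<le> \<delta>" using mult_right_mono[OF less_one \<open>\<delta> \<ge> 0\<close>] by simp
  finally have "\<bar>yi - xstar $ i\<bar> \<le> \<delta>" .
  then have near_y': "\<bar>y' $ j - xstar $ j\<bar> \<le> \<delta>" if "j \<in> insert i (nbrs f i)" for j
    using near_xy(2)[OF that] by (auto simp: y'_def upd_entry_def)
  have "yi \<in> Xs i" unfolding yi_def
    using xstar_mem box(2) by (intro closest_point_in_set) (auto simp: box_product_def)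
  then have "y' \<in> ?X" using mem by (auto simp: y'_def upd_entry_def box_product_def)
  have xi: "\<bar>closest_point (Xs i) (w' $ i - \<gamma> * partial_deriv i f w') - xstar $ i\<bar>
      \<le> (1 - \<gamma> * \<mu>) * (1 + 2 * lam) * \<delta>"
    by (rule half_step[OF \<open>y' \<in> ?X\<close> mem(1) w'_def]) (use near_y' near_xy in blast)
  have "w' $ i = yi + lam * (yi - x $ i)" by (simp add: w'_def y'_def upd_entry_def)
  then have "nag_update f Xs \<gamma> lam i p
      = (closest_point (Xs i) (w' $ i - \<gamma> * partial_deriv i f w'), yi)"
    unfolding nag_update_def Let_def xy fst_conv snd_conv
      w_def[symmetric] yi_def[symmetric] y'_def[symmetric] w'_def[symmetric]
    by (simp only:)
  then show ?thesis using xi yi by (simp add: entry_near_def)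
qed

section \<open>Runs of the algorithm\<close>

lemma entry_prod_in_box_iff:
  "p \<in> box_product Xs \<times> box_product Xs \<longleftrightarrow> (\<forall>j. entry p j \<in> Xs j \<times> Xs j)"
  by (cases p) (auto simp: entry_def box_product_def)

lemma nag_update_mem:
  assumes "closed (Xs i)" "Xs i \<noteq> {}"
  shows "nag_update f Xs \<gamma> lam i p \<in> Xs i \<times> Xs i"
  using assms by (simp add: nag_update_def Let_def closest_point_in_set)

lemma nag_runD:
  assumes "nag_run f Xs \<gamma> lam K S R \<tau> z"
  shows "z i 0 \<in> box_product Xs \<times> box_product Xs"
    and "S i j \<subseteq> K i"
    and "j \<notin> nbrs f i \<Longrightarrow> R i j = {}"
    and "k \<in> K i \<Longrightarrow> entry (z i (Suc k)) i = nag_update f Xs \<gamma> lam i (z i k)"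
    and "k \<notin> K i \<Longrightarrow> entry (z i (Suc k)) i = entry (z i k) i"
    and "j \<noteq> i \<Longrightarrow> k \<in> R i j \<Longrightarrow> \<tau> i j (Suc k) \<in> S j i \<and> \<tau> i j (Suc k) \<le> k \<and>
           entry (z i (Suc k)) j = entry (z j (Suc (\<tau> i j (Suc k)))) j"
    and "j \<noteq> i \<Longrightarrow> k \<notin> R i j \<Longrightarrow> \<tau> i j (Suc k) = \<tau> i j k \<and> entry (z i (Suc k)) j = entry (z i k) j"
  using assms unfolding nag_run_def by (auto split: if_splits)

lemma nag_run_in_box:
  fixes z :: "'n::finite \<Rightarrow> nat \<Rightarrow> (real^'n) \<times> (real^'n)"
  assumes run: "nag_run f Xs \<gamma> lam K S R \<tau> z"
    and Xs: "\<And>i. closed (Xs i)" "\<And>i. Xs i \<noteq> {}"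
  shows "z i k \<in> box_product Xs \<times> box_product Xs"
proof -
  have own: "entry (z i k) i \<in> Xs i \<times> Xs i" for i k
  proof (induction k)
    case 0
    then show ?case using nag_runD(1)[OF run] by (simp add: entry_prod_in_box_iff)
  next
    case (Suc k)
    show ?case
    proof (cases "k \<in> K i")
      case True
      then show ?thesis by (simp add: nag_runD(4)[OF run] nag_update_mem Xs del: mem_Times_iff)
    next
      case False
      then show ?thesis using Suc by (simp add: nag_runD(5)[OF run] del: mem_Times_iff)
    qed
  qed
  have "entry (z i k) j \<in> Xs j \<times> Xs j" for j
  proof (cases "j = i")
    case True
    then show ?thesis using own by simp
  next
    case False
    show ?thesis
    proof (induction k)
      case 0
      then show ?case using nag_runD(1)[OF run] by (simp add: entry_prod_in_box_iff)
    next
      case (Suc k)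
      then show ?case using nag_runD(6,7)[OF run False, where k = k] own by metis
    qed
  qed
  then show ?thesis by (simp add: entry_prod_in_box_iff)
qed

lemma own_entry_from_recent_update:
  assumes run: "nag_run f Xs \<gamma> lam K S R \<tau> z" and "c \<in> K i" "s \<le> c" "c < k"
  shows "\<exists>c'\<in>K i. s \<le> c' \<and> entry (z i k) i = entry (z i (Suc c')) i"
  using \<open>c < k\<close>
proof (induction k)
  case (Suc k)
  show ?case
  proof (cases "k \<in> K i")
    case True
    then show ?thesis using Suc.prems \<open>s \<le> c\<close> by (intro bexI[of _ k]) auto
  next
    case False
    then have "c < k" using Suc.prems \<open>c \<in> K i\<close> by (metis less_SucE)
    then show ?thesis using Suc.IH nag_runD(5)[OF run False] by metis
  qed
qed simp

lemma received_entry_from_sent_update: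
  assumes run: "nag_run f Xs \<gamma> lam K S R \<tau> z" and "j \<noteq> i" and "r \<in> R i j" "r < k"
  shows "\<tau> i j k \<in> S j i \<and> entry (z i k) j = entry (z j (Suc (\<tau> i j k))) j"
  using \<open>r < k\<close>
proof (induction k)
  case (Suc k)
  show ?case
  proof (cases "k \<in> R i j")
    case True
    then show ?thesis using nag_runD(6)[OF run \<open>j \<noteq> i\<close>] by blast
  next
    case False
    then have "r < k" using Suc.prems \<open>r \<in> R i j\<close> by (metis less_SucE)
    then show ?thesis using Suc.IH nag_runD(7)[OF run \<open>j \<noteq> i\<close> False] by metis
  qed
qed simp

lemma non_nbr_entry_constant:
  assumes run: "nag_run f Xs \<gamma> lam K S R \<tau> z" and "j \<noteq> i" "j \<notin> nbrs f i"
  shows "entry (z i k) j = entry (z i 0) j"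
proof (induction k)
  case (Suc k)
  have "k \<notin> R i j" using nag_runD(3)[OF run \<open>j \<notin> nbrs f i\<close>] by simp
  then show ?case using nag_runD(7)[OF run \<open>j \<noteq> i\<close>] Suc.IH by metis
qed simp


section \<open>Operation cycles\<close>

text \<open>Induction over completed cycles: \<open>P m s\<close> speaks of the time \<open>s\<close> at which cycle number
  \<open>m\<close>, counted from \<open>0\<close>, begins.\<close>

lemma cycle_state_induct:
  assumes start: "P 0 0"
    and cycle: "\<And>m s t. P m s \<Longrightarrow> s < t \<Longrightarrow> cycle_done N K S R \<tau> s t \<Longrightarrow> P (Suc m) t"
  obtains s where "s \<le> k" "P (ops N K S R \<tau> k) s"
proof -
  have "snd (cycle_state N K S R \<tau> k) \<le> k \<and>
      P (fst (cycle_state N K S R \<tau> k)) (snd (cycle_state N K S R \<tau> k))"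
  proof (induction k)
    case (Suc k)
    then show ?case
      using cycle[of "fst (cycle_state N K S R \<tau> k)" "snd (cycle_state N K S R \<tau> k)" "Suc k"]
      by (simp add: split_beta Let_def)
  qed (simp add: start)
  then show ?thesis using that unfolding ops_def by blast
qed

lemma card_events_before_less:
  fixes A :: "nat set"
  assumes "c \<in> A" "s \<le> c" "c < t"
  shows "Suc (card {c \<in> A. c < s}) \<le> card {c \<in> A. c < t}"
proof -
  have "card (insert c {c \<in> A. c < s}) \<le> card {c \<in> A. c < t}"
    using assms by (intro card_mono) auto
  then show ?thesis using assms by simp
qed

lemma card_events_before_mono: "s \<le> t \<Longrightarrow> card {c \<in> A. c < s} \<le> card {c \<in> A. c < (t::nat)}"
  by (intro card_mono) auto

lemma ops_le_num_computations: "ops N K S R \<tau> k \<le> num_computations K i k"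
proof -
  obtain s where "s \<le> k" "ops N K S R \<tau> k \<le> card {c \<in> K i. c < s}"
  proof (rule cycle_state_induct[of "\<lambda>m s. m \<le> card {c \<in> K i. c < s}" N K S R \<tau> k])
    fix m s t assume m: "m \<le> card {c \<in> K i. c < s}" and "cycle_done N K S R \<tau> s t"
    then obtain c where "c \<in> K i" "s \<le> c" "c < t"
      unfolding cycle_done_def by blast
    then show "Suc m \<le> card {c \<in> K i. c < t}"
      using card_events_before_less[of c "K i" s t] m by simp
  qed auto
  then show ?thesis
    using card_events_before_mono[of s k "K i"] by (simp add: num_computations_def)
qed

lemma ops_le_num_sent:
  assumes "j \<in> N i"
  shows "ops N K S R \<tau> k \<le> card {c \<in> S i j. c < k}"
proof -
  obtain s where "s \<le> k" "ops N K S R \<tau> k \<le> card {c \<in> S i j. c < s}"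
  proof (rule cycle_state_induct[of "\<lambda>m s. m \<le> card {c \<in> S i j. c < s}" N K S R \<tau> k])
    fix m s t assume m: "m \<le> card {c \<in> S i j. c < s}" and "cycle_done N K S R \<tau> s t"
    then obtain c r where "c \<in> S i j" "s \<le> c" "c \<le> r" "r < t"
      unfolding cycle_done_def using assms by blast
    then show "Suc m \<le> card {c \<in> S i j. c < t}"
      using card_events_before_less[of c "S i j" s t] m by simp
  qed auto
  then show ?thesis using card_events_before_mono[of s k "S i j"] by simp
qed

lemma card_nbrs_ops_le_num_communications:
  fixes N :: "'n::finite \<Rightarrow> 'n set"
  shows "card (N i) * ops N K S R \<tau> k \<le> num_communications S i k"
proof -
  have "card (N i) * ops N K S R \<tau> k \<le> (\<Sum>j\<in>N i. card {c \<in> S i j. c < k})"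
    using sum_bounded_below[of "N i" "ops N K S R \<tau> k" "\<lambda>j. card {c \<in> S i j. c < k}"]
    by (simp add: ops_le_num_sent)
  also have "\<dots> \<le> num_communications S i k"
    unfolding num_communications_def by (intro sum_mono2) auto
  finally show ?thesis .
qed

lemma ops_unbounded:
  assumes "\<And>s. \<exists>t>s. cycle_done N K S R \<tau> s t"
  shows "\<exists>k. m \<le> ops N K S R \<tau> k"
proof (induction m)
  case (Suc m)
  let ?c = "cycle_state N K S R \<tau>"
  obtain k where k: "m \<le> fst (?c k)" using Suc.IH by (auto simp: ops_def)
  show ?case
  proof (rule ccontr)
    assume "\<nexists>k. Suc m \<le> ops N K S R \<tau> k"
    then have small: "fst (?c k) \<le> m" for k by (simp add: ops_def not_less_eq_eq)
    \<comment> \<open>The count cannot pass \<open>m\<close>, so from time \<open>k\<close> on the same cycle stays open.\<close>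
    have stuck: "?c (k + l) = (m, snd (?c k))" for l
    proof (induction l)
      case 0
      then show ?case using k small[of k] by (simp add: prod_eq_iff)
    next
      case (Suc l)
      then show ?case using small[of "Suc (k + l)"] by (auto split: if_splits)
    qed
    obtain t where t: "t > snd (?c k)" "cycle_done N K S R \<tau> (snd (?c k)) t" using assms by blast
    have mono_t: "cycle_done N K S R \<tau> s t \<Longrightarrow> t \<le> t' \<Longrightarrow> cycle_done N K S R \<tau> s t'" for s t t'
      unfolding cycle_done_def by (meson less_le_trans order_trans)
    then have "cycle_done N K S R \<tau> (snd (?c k)) (Suc (k + t))" using t(2) by simp
    then have "fst (?c (Suc (k + t))) = Suc m" using stuck[of t] by simp
    then show False using small[of "Suc (k + t)"] by simp
  qed
qed simp

text \<open>With ordered channels \<open>\<tau>\<close> is nondecreasing, so that the divergence along the update times of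
  the receiver becomes divergence along all times. So every message received late enough carries a
  value computed at time \<open>s\<close> or later, and no older value ever replaces it. By the symmetry of the neighbor
  relation, there is such a message on every channel that the cycle begun at \<open>s\<close> waits for.\<close>

lemma eventually_cycle_done:
  fixes f :: "real^'n::finite \<Rightarrow> real"
  assumes run: "nag_run f Xs \<gamma> lam K S R \<tau> z"
    and sym: "\<And>i j. j \<in> nbrs f i \<Longrightarrow> i \<in> nbrs f j"
    and K_inf: "\<And>i. infinite (K i)"
    and R_inf: "\<And>i j. j \<in> nbrs f i \<Longrightarrow> infinite (R i j)"
    and tau_lim: "\<And>i j ks. j \<in> nbrs f i \<Longrightarrow> strict_mono ks \<Longrightarrow> range ks \<subseteq> K i \<Longrightarrow>
          filterlim (\<lambda>s. \<tau> i j (ks s)) at_top sequentially"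
    and tau_mono: "\<And>i j. j \<in> nbrs f i \<Longrightarrow> mono (\<tau> i j)"
  shows "\<exists>t>s. cycle_done (nbrs f) K S R \<tau> s t"
proof -
  have computed: "\<exists>c\<in>K i. s \<le> c" for i
    using K_inf[of i] by (auto simp: infinite_nat_iff_unbounded_le)
  have received: "\<exists>c\<in>S i j. s \<le> c \<and> (\<exists>r\<in>R j i. c \<le> r \<and> \<tau> j i (Suc r) = c \<and> (\<forall>k>r. s \<le> \<tau> j i k))"
    if ji: "j \<in> nbrs f i" for i j
  proof -
    have ij: "i \<in> nbrs f j" "i \<noteq> j" using sym[OF ji] by (auto simp: nbrs_def)
    have "filterlim (\<lambda>l. \<tau> j i (enumerate (K j) l)) at_top sequentially"
      using K_inf by (intro tau_lim ij strict_mono_enumerate) (auto simp: enumerate_in_set)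
    then obtain l where l: "s \<le> \<tau> j i (enumerate (K j) l)"
      by (auto simp: filterlim_at_top eventually_sequentially)
    have late: "s \<le> \<tau> j i k" if "k \<ge> enumerate (K j) l" for k
      using monoD[OF tau_mono[OF ij(1)] that] l by simp
    obtain r where r: "r \<in> R j i" "r \<ge> enumerate (K j) l"
      using R_inf[OF ij(1)] by (meson infinite_nat_iff_unbounded_le)
    show ?thesis
      using nag_runD(6)[OF run ij(2) r(1)] r late
      by (intro bexI[of _ "\<tau> j i (Suc r)"] conjI bexI[of _ r]) auto
  qed
  obtain c where c: "\<And>i. c i \<in> K i \<and> s \<le> c i" using computed by metis
  have "\<exists>r. \<forall>i j. j \<in> nbrs f i \<longrightarrow> r i j \<in> R j i \<and> \<tau> j i (Suc (r i j)) \<in> S i j \<and>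
      s \<le> \<tau> j i (Suc (r i j)) \<and> \<tau> j i (Suc (r i j)) \<le> r i j \<and> (\<forall>k>r i j. s \<le> \<tau> j i k)"
    using received by (intro choice allI) metis
  then obtain r where r: "\<And>i j. j \<in> nbrs f i \<Longrightarrow> r i j \<in> R j i \<and> \<tau> j i (Suc (r i j)) \<in> S i j \<and>
      s \<le> \<tau> j i (Suc (r i j)) \<and> \<tau> j i (Suc (r i j)) \<le> r i j \<and> (\<forall>k>r i j. s \<le> \<tau> j i k)"
    by blast
  define t where "t = Suc (Max (range c \<union> range (\<lambda>(i, j). r i j)))"
  have ct: "c i < t" for i unfolding t_def by (auto simp: less_Suc_eq_le intro!: Max_ge)
  have rt: "r i j < t" for i j
    unfolding t_def by (auto simp: less_Suc_eq_le intro!: Max_ge rev_image_eqI[of "(i, j)"])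
  have "s < t" using c[of undefined] ct[of undefined] by simp
  moreover have "cycle_done (nbrs f) K S R \<tau> s t"
    unfolding cycle_done_def
  proof (intro allI conjI ballI impI)
    show "\<exists>a\<in>K i. s \<le> a \<and> a < t" for i using c ct by blast
    fix i j assume ij: "j \<in> nbrs f i"
    show "\<exists>a\<in>S i j. s \<le> a \<and> (\<exists>r\<in>R j i. a \<le> r \<and> r < t \<and> \<tau> j i (Suc r) = a)"
      using r[OF ij] rt by blast
    show "s \<le> \<tau> j i k" if "k \<ge> t" for k
      using r[OF ij] rt[of i j] that by simp
  qed
  ultimately show ?thesis by blast
qed

text \<open>A cycle replaces every value that an agent uses: at its end, each essential entry of each local
  state is the result of an update computed since its beginning. Such an update started from entries
  that already satisfied the bound of the previous cycle, so it gained another factor \<open>\<alpha>\<close>.\<close>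

lemma error_bound_ops:
  fixes f :: "real^'n::finite \<Rightarrow> real"
  assumes run: "nag_run f Xs \<gamma> lam K S R \<tau> z"
    and sym: "\<And>i j. j \<in> nbrs f i \<Longrightarrow> i \<in> nbrs f j"
    and contraction: "\<And>i k \<delta>. (\<And>j. j \<in> insert i (nbrs f i) \<Longrightarrow> entry_near \<delta> (xstar $ j) (entry (z i k) j))
          \<Longrightarrow> entry_near (\<alpha> * \<delta>) (xstar $ i) (nag_update f Xs \<gamma> lam i (z i k))"
    and init: "\<And>i k j. entry_near D (xstar $ j) (entry (z i k) j)"
    and j: "j \<in> insert i (nbrs f i)"
  shows "entry_near (\<alpha> ^ ops (nbrs f) K S R \<tau> k * D) (xstar $ j) (entry (z i k) j)"
proof -
  define P where "P m s \<longleftrightarrow> (\<forall>k\<ge>s. \<forall>i. \<forall>j\<in>insert i (nbrs f i).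
      entry_near (\<alpha> ^ m * D) (xstar $ j) (entry (z i k) j))" for m s
  obtain s where "s \<le> k" "P (ops (nbrs f) K S R \<tau> k) s"
  proof (rule cycle_state_induct[of P "nbrs f" K S R \<tau> k])
    show "P 0 0" using init by (simp add: P_def)
  next
    fix m s t assume P: "P m s" and "s < t" and cd: "cycle_done (nbrs f) K S R \<tau> s t"
    have fresh: "entry_near (\<alpha> ^ Suc m * D) (xstar $ i) (entry (z i (Suc c)) i)"
      if "c \<in> K i" "s \<le> c" for i c
    proof -
      have "entry_near (\<alpha> * (\<alpha> ^ m * D)) (xstar $ i) (nag_update f Xs \<gamma> lam i (z i c))"
        using P that(2) unfolding P_def by (intro contraction) blast
      then show ?thesis using nag_runD(4)[OF run that(1)] by (simp add: mult.assoc)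
    qed
    show "P (Suc m) t"
      unfolding P_def
    proof (intro allI impI ballI)
      fix k i j assume k: "t \<le> k" and j: "j \<in> insert i (nbrs f i)"
      show "entry_near (\<alpha> ^ Suc m * D) (xstar $ j) (entry (z i k) j)"
      proof (cases "j = i")
        case True
        obtain c where "c \<in> K i" "s \<le> c" "c < k"
          using cd k unfolding cycle_done_def by (meson less_le_trans)
        then show ?thesis using own_entry_from_recent_update[OF run] fresh True by metis
      next
        case False
        then have "i \<in> nbrs f j" using j sym by blast
        then obtain r where r: "r \<in> R i j" "r < k" and late: "s \<le> \<tau> i j k"
          using cd k unfolding cycle_done_def by (meson less_le_trans)
        show ?thesis
          using received_entry_from_sent_update[OF run False r] fresh[OF _ late] nag_runD(2)[OF run]
          by (metis subsetD)
      qed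
    qed
  qed
  then show ?thesis using j unfolding P_def by blast
qed


section \<open>Distances and rates\<close>

lemma infnorm_pair_le_iff:
  fixes p :: "(real^'n::finite) \<times> (real^'n)"
  shows "infnorm p \<le> \<delta> \<longleftrightarrow> (\<forall>j. \<bar>fst p $ j\<bar> \<le> \<delta> \<and> \<bar>snd p $ j\<bar> \<le> \<delta>)"
proof -
  have "infnorm p \<le> \<delta> \<longleftrightarrow> (\<forall>b\<in>Basis. \<bar>p \<bullet> b\<bar> \<le> \<delta>)"
    unfolding infnorm_Max by simp
  also have "\<dots> \<longleftrightarrow> (\<forall>j. \<bar>fst p $ j\<bar> \<le> \<delta> \<and> \<bar>snd p $ j\<bar> \<le> \<delta>)"
    by (cases p) (auto simp: Basis_prod_def Basis_vec_def inner_axis ball_Un)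
  finally show ?thesis .
qed

lemma infnorm_diff_le_iff_entry_near:
  "infnorm (p - (a, a)) \<le> \<delta> \<longleftrightarrow> (\<forall>j. entry_near \<delta> (a $ j) (entry p j))"
  by (simp add: infnorm_pair_le_iff entry_near_def entry_def)

lemma infnorm_on_diff_le_iff_entry_near:
  assumes "J \<noteq> {}"
  shows "infnorm_on J (p - (a, a)) \<le> \<delta> \<longleftrightarrow> (\<forall>j\<in>J. entry_near \<delta> (a $ j) (entry p j))"
  using assms by (simp add: infnorm_on_def entry_near_def entry_def)

lemma infnorm_diff_le_diameter:
  fixes X :: "(real^'n::finite) set"
  assumes "compact X" and v: "v1 \<in> X \<times> X" "v2 \<in> X \<times> X"
  shows "infnorm (v1 - v2) \<le> (SUP (v1, v2) \<in> (X \<times> X) \<times> (X \<times> X). infnorm (v1 - v2))"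
proof -
  have "compact ((\<lambda>(v1, v2). infnorm (v1 - v2)) ` ((X \<times> X) \<times> (X \<times> X)))"
    unfolding split_beta
    by (intro compact_continuous_image compact_Times assms continuous_intros)
  then have "bdd_above ((\<lambda>(v1, v2). infnorm (v1 - v2)) ` ((X \<times> X) \<times> (X \<times> X)))"
    by (intro bounded_imp_bdd_above compact_imp_bounded)
  then show ?thesis
    using cSUP_upper[of "(v1, v2)" "(X \<times> X) \<times> (X \<times> X)" "\<lambda>(v1, v2). infnorm (v1 - v2)"] v by simp
qed

lemma geometric_le_iff_log_le:
  fixes \<alpha> D \<epsilon> :: real
  assumes "0 < \<alpha>" "\<alpha> < 1" "\<epsilon> > 0" "D \<ge> 0"
  shows "\<alpha> ^ m * D \<le> \<epsilon> \<longleftrightarrow> ln (\<epsilon> / D) / ln \<alpha> \<le> real m"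
proof (cases "D = 0")
  case True
  \<comment> \<open>Here \<open>\<epsilon> / D = 0\<close> and \<open>ln 0 = 0\<close>, so both sides hold for every \<open>m\<close>.\<close>
  then show ?thesis using assms by simp
next
  case False
  then have "D > 0" using assms by simp
  have "\<alpha> ^ m * D \<le> \<epsilon> \<longleftrightarrow> \<alpha> ^ m \<le> \<epsilon> / D"
    using \<open>D > 0\<close> by (simp add: field_simps)
  also have "\<dots> \<longleftrightarrow> ln (\<alpha> ^ m) \<le> ln (\<epsilon> / D)"
    using assms \<open>D > 0\<close> by simp
  also have "\<dots> \<longleftrightarrow> real m * ln \<alpha> \<le> ln (\<epsilon> / D)"
    using assms by (simp add: ln_realpow)
  also have "\<dots> \<longleftrightarrow> ln (\<epsilon> / D) / ln \<alpha> \<le> real m"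
    using assms by (simp add: neg_divide_le_eq)
  finally show ?thesis .
qed

text \<open>With \<open>q = 1 - \<gamma> \<mu>\<close>, the upper bound on \<open>lam\<close> says \<open>2 lam q < 1 - q\<close>. At
  equality both rates \<open>\<alpha>2\<close> and \<open>\<alpha>1\<close> below are exactly \<open>1\<close>.\<close>

lemma rates_less_one:
  fixes q lam :: real
  assumes "0 < q" "lam > 0" "2 * lam * q < 1 - q"
  shows "q * (1 + 2 * lam) < 1"
    and "(q * (1 + lam))\<^sup>2 + lam * q + lam * q * (q * (1 + lam)) < 1"
proof -
  show "q * (1 + 2 * lam) < 1" using assms by (simp add: algebra_simps)
  define u where "u = q * (1 + lam)"
  have "0 < 2 * lam * q" using assms by simp
  then have "q < 1" using assms(3) by linarith
  have u: "0 < u" "u < (1 + q) / 2" using assms by (simp_all add: u_def field_simps add_pos_pos)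
  have "u\<^sup>2 < ((1 + q) / 2)\<^sup>2" using u by (intro power_strict_mono) auto
  moreover have "lam * q < (1 - q) / 2" using assms by simp
  moreover have "lam * q * u < (1 - q) / 2 * ((1 + q) / 2)"
    using assms u \<open>q < 1\<close> by (intro mult_strict_mono) auto
  moreover have "((1 + q) / 2)\<^sup>2 + (1 - q) / 2 + (1 - q) / 2 * ((1 + q) / 2) = 1"
    by (simp add: power2_eq_square field_simps)
  ultimately show "u\<^sup>2 + lam * q + lam * q * u < 1" by linarith
qed

theorem theorem3:
  fixes f :: "real^'n::finite \<Rightarrow> real"
    and F :: "'n \<Rightarrow> ('n \<Rightarrow> real) \<Rightarrow> real"
    and Xs :: "'n \<Rightarrow> real set" and X :: "(real^'n) set" and xstar :: "real^'n"
    and \<mu> \<gamma> lam \<epsilon> \<alpha> \<alpha>1 \<alpha>2 \<beta> D0 :: real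
    and K :: "'n \<Rightarrow> nat set" and S R :: "'n \<Rightarrow> 'n \<Rightarrow> nat set"
    and \<tau> :: "'n \<Rightarrow> 'n \<Rightarrow> nat \<Rightarrow> nat"
    and z :: "'n \<Rightarrow> nat \<Rightarrow> (real^'n) \<times> (real^'n)"
  assumes X_def: "X = box_product Xs"
    and X: "X \<noteq> {}" "convex X" "compact X"
    and f_sum: "\<And>x. f x = (\<Sum>i\<in>UNIV. F i (restrict (\<lambda>j. x $ j) (insert i (nbrs f i))))"
    and f_C2: "twice_continuously_differentiable f"
    and mu_pos: "\<mu> > 0"
    and dominant: "\<And>x i. x \<in> X \<Longrightarrow>
          hessian f x $ i $ i \<ge> \<mu> + (\<Sum>j\<in>UNIV - {i}. \<bar>hessian f x $ i $ j\<bar>)"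
    and minimizer: "is_arg_min f (\<lambda>x. x \<in> X) xstar"
    and K_inf: "\<And>i. infinite (K i)"
    and R_inf: "\<And>i j. j \<in> nbrs f i \<Longrightarrow> infinite (R i j)"
    and tau_lim: "\<And>i j ks. j \<in> nbrs f i \<Longrightarrow> strict_mono ks \<Longrightarrow> range ks \<subseteq> K i \<Longrightarrow>
          filterlim (\<lambda>s. \<tau> i j (ks s)) at_top sequentially"
    and eps_pos: "\<epsilon> > 0"
    and gamma: "\<gamma> \<in> {0 <..< 1 / (MAX i\<in>UNIV. SUP \<eta>\<in>X. \<bar>hessian f \<eta> $ i $ i\<bar>)}"
    and lam: "lam \<in> {0 <..< \<gamma> * \<mu> / (2 * (1 - \<gamma> * \<mu>))}"
    and extrapolated: "\<And>x y w i. x \<in> X \<Longrightarrow> y \<in> X \<Longrightarrow> w = x + lam *\<^sub>R (x - y) \<Longrightarrow>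
          hessian f w $ i $ i \<ge> \<mu> + (\<Sum>j\<in>UNIV - {i}. \<bar>hessian f w $ i $ j\<bar>) \<and>
          \<gamma> * \<bar>hessian f w $ i $ i\<bar> \<le> 1"
    and run: "nag_run f Xs \<gamma> lam K S R \<tau> z"
    and alpha1: "\<alpha>1 = (1 + lam - \<gamma> * \<mu> * (1 + lam))\<^sup>2 + lam * (1 - \<gamma> * \<mu>)
                    + lam * (1 - \<gamma> * \<mu>) * (1 + lam - \<gamma> * \<mu> * (1 + lam))"
    and alpha2: "\<alpha>2 = 1 - \<gamma> * \<mu> + 2 * lam * (1 - \<gamma> * \<mu>)"
    and alpha: "\<alpha> = max \<alpha>1 \<alpha>2"
    and D0: "D0 = (SUP (v1, v2) \<in> (X \<times> X) \<times> (X \<times> X). infnorm (v1 - v2))"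
    and beta: "\<beta> = ln (\<epsilon> / D0) / ln \<alpha>"
  shows
    "(\<forall>k. (MAX i\<in>UNIV. infnorm_on (insert i (nbrs f i)) (z i k - (xstar, xstar)))
            \<le> \<alpha> ^ ops (nbrs f) K S R \<tau> k * D0) \<and>
     (\<forall>k. \<alpha> ^ ops (nbrs f) K S R \<tau> k * D0 \<le> \<epsilon> \<longleftrightarrow> \<beta> \<le> real (ops (nbrs f) K S R \<tau> k)) \<and>
     (\<forall>k. \<beta> \<le> real (ops (nbrs f) K S R \<tau> k) \<longrightarrow>
        (MAX i\<in>UNIV. infnorm_on (insert i (nbrs f i)) (z i k - (xstar, xstar))) \<le> \<epsilon> \<and>
        ((\<forall>i m. m \<notin> insert i (nbrs f i) \<longrightarrow> infnorm_on {m} (z i 0 - (xstar, xstar)) \<le> \<epsilon>) \<longrightarrow>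
          (MAX i\<in>UNIV. infnorm (z i k - (xstar, xstar))) \<le> \<epsilon>) \<and>
        (\<forall>i. \<beta> \<le> real (num_computations K i k) \<and>
             \<beta> * real (card (nbrs f i)) \<le> real (num_communications S i k))) \<and>
     ((\<forall>i. \<forall>j\<in>nbrs f i. mono (\<tau> i j)) \<longrightarrow> (\<exists>k. \<beta> \<le> real (ops (nbrs f) K S R \<tau> k)))"
proof -
  let ?J = "\<lambda>i. insert i (nbrs f i)"
  let ?ops = "ops (nbrs f) K S R \<tau>"
  let ?err = "\<lambda>k. MAX i\<in>UNIV. infnorm_on (?J i) (z i k - (xstar, xstar))"
  have diff: "f differentiable (at x)" and diff2: "partial_deriv i f differentiable (at x)" for x i
    using f_C2 by (auto simp: twice_continuously_differentiable_def)
  have sym: "\<And>i j. j \<in> nbrs f i \<Longrightarrow> i \<in> nbrs f j" using nbrs_sym[OF diff] .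
  have Xs: "closed (Xs i)" "convex (Xs i)" "Xs i \<noteq> {}" for i
    using box_product_component X unfolding X_def by blast+
  have "0 < \<gamma>" "0 < lam" "lam < \<gamma> * \<mu> / (2 * (1 - \<gamma> * \<mu>))" using gamma lam by auto
  define q where "q = 1 - \<gamma> * \<mu>"
  \<comment> \<open>The interval for \<open>lam\<close> is nonempty, so its right end point and hence its denominator are positive.\<close>
  have "0 < (1 - q) / (2 * q)" "lam < (1 - q) / (2 * q)"
    using \<open>0 < lam\<close> \<open>lam < _\<close> by (auto simp: q_def)
  moreover have "0 < 1 - q" using \<open>0 < \<gamma>\<close> mu_pos by (simp add: q_def)
  ultimately have "0 < q" "2 * lam * q < 1 - q"
    by (auto simp: zero_less_divide_iff field_simps)
  note less_one = rates_less_one[OF \<open>0 < q\<close> \<open>0 < lam\<close> \<open>2 * lam * q < 1 - q\<close>]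
  have "\<alpha>1 = (q * (1 + lam))\<^sup>2 + lam * q + lam * q * (q * (1 + lam))"
    unfolding alpha1 q_def by (simp add: algebra_simps)
  moreover have alpha2': "\<alpha>2 = q * (1 + 2 * lam)"
    unfolding alpha2 q_def by (simp add: algebra_simps)
  ultimately have "\<alpha> < 1" "\<alpha>2 \<le> \<alpha>" using less_one by (simp_all add: alpha)
  moreover have "0 < \<alpha>2" using \<open>0 < q\<close> \<open>0 < lam\<close> by (simp add: alpha2')
  ultimately have "0 < \<alpha>" by simp
  have "xstar \<in> X" using minimizer by (simp add: is_arg_min_def)
  then have "0 \<le> D0"
    using infnorm_diff_le_diameter[OF X(3), of "(xstar, xstar)" "(xstar, xstar)"]
    by (simp add: D0 infnorm_0)
  have box: "z i k \<in> X \<times> X" for i k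
    using nag_run_in_box[OF run Xs(1,3)] by (simp add: X_def)
  have init: "entry_near D0 (xstar $ j) (entry (z i k) j)" for i j k
    using infnorm_diff_le_diameter[OF X(3) box, of "(xstar, xstar)" i k] \<open>xstar \<in> X\<close>
    by (simp add: infnorm_diff_le_iff_entry_near flip: D0)
  have contraction: "entry_near (\<alpha> * \<delta>) (xstar $ i) (nag_update f Xs \<gamma> lam i (z i k))"
    if near: "\<And>j. j \<in> ?J i \<Longrightarrow> entry_near \<delta> (xstar $ j) (entry (z i k) j)" for i k \<delta>
  proof -
    have "entry_near (\<alpha>2 * \<delta>) (xstar $ i) (nag_update f Xs \<gamma> lam i (z i k))"
      unfolding alpha2' q_def
    proof (rule nag_update_contraction[OF diff diff2 _ Xs(1,2)])
      show "z i k \<in> box_product Xs \<times> box_product Xs" using box by (simp add: X_def)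
      show "(1 - \<gamma> * \<mu>) * (1 + 2 * lam) \<le> 1" using less_one(1) by (simp add: q_def)
    qed (use X(2) minimizer extrapolated \<open>0 < \<gamma>\<close> \<open>0 < lam\<close> near in \<open>simp_all add: X_def\<close>)
    moreover have "0 \<le> \<delta>" using near[of i] by (auto simp: entry_near_def)
    ultimately show ?thesis
      using \<open>\<alpha>2 \<le> \<alpha>\<close> by (auto elim: entry_near_mono intro: mult_right_mono)
  qed
  have near: "entry_near (\<alpha> ^ ?ops k * D0) (xstar $ j) (entry (z i k) j)" if "j \<in> ?J i" for i j k
    using error_bound_ops[OF run sym contraction init that] .
  have err: "?err k \<le> \<alpha> ^ ?ops k * D0" for k
    using near by (simp add: infnorm_on_diff_le_iff_entry_near)
  have iff: "\<alpha> ^ ?ops k * D0 \<le> \<epsilon> \<longleftrightarrow> \<beta> \<le> real (?ops k)" for k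
    unfolding beta using \<open>0 < \<alpha>\<close> \<open>\<alpha> < 1\<close> eps_pos \<open>0 \<le> D0\<close> by (rule geometric_le_iff_log_le)
  have full: "(MAX i\<in>UNIV. infnorm (z i k - (xstar, xstar))) \<le> \<epsilon>"
    if k: "\<beta> \<le> real (?ops k)"
      and rest: "\<forall>i m. m \<notin> ?J i \<longrightarrow> infnorm_on {m} (z i 0 - (xstar, xstar)) \<le> \<epsilon>" for k
  proof -
    have "entry_near \<epsilon> (xstar $ j) (entry (z i k) j)" for i j
    proof (cases "j \<in> ?J i")
      case True
      then show ?thesis using near iff k entry_near_mono by blast
    next
      case False
      then have "infnorm_on {j} (z i 0 - (xstar, xstar)) \<le> \<epsilon>" using rest by blast
      then show ?thesis
        using non_nbr_entry_constant[OF run, of j i k] False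
        by (simp add: infnorm_on_diff_le_iff_entry_near)
    qed
    then show ?thesis by (simp add: infnorm_diff_le_iff_entry_near)
  qed
  have computations: "\<beta> \<le> real (num_computations K i k)" if "\<beta> \<le> real (?ops k)" for i k
    using that ops_le_num_computations[of "nbrs f" K S R \<tau> k i] by linarith
  have communications: "\<beta> * real (card (nbrs f i)) \<le> real (num_communications S i k)"
    if "\<beta> \<le> real (?ops k)" for i k
  proof -
    have "\<beta> * real (card (nbrs f i)) \<le> real (?ops k) * real (card (nbrs f i))"
      using that by (simp add: mult_right_mono)
    also have "\<dots> = real (card (nbrs f i) * ?ops k)" by simp
    also have "\<dots> \<le> real (num_communications S i k)"
      using card_nbrs_ops_le_num_communications[of "nbrs f"] by (intro of_nat_mono)
    finally show ?thesis .
  qed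
  have reached: "\<exists>k. \<beta> \<le> real (?ops k)" if "\<forall>i. \<forall>j\<in>nbrs f i. mono (\<tau> i j)"
  proof -
    have "\<exists>t>s. cycle_done (nbrs f) K S R \<tau> s t" for s
      using eventually_cycle_done[OF run sym K_inf R_inf tau_lim] that by blast
    then obtain k where "nat \<lceil>\<beta>\<rceil> \<le> ?ops k" using ops_unbounded by blast
    then show ?thesis by (intro exI[of _ k]) linarith
  qed
  have err_eps: "?err k \<le> \<epsilon>" if "\<beta> \<le> real (?ops k)" for k
    using err iff that order_trans by blast
  show ?thesis
    by (intro conjI allI impI;
        (rule err iff | (rule err_eps full computations communications reached; assumption)))
qed

end
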